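(* Let $0<q<1$ and let $E_{n,q}(x)$, $B_{n,q}(x)$ and $B_{n,q}$ be as defined in the context. Then for every integer $n \geq 2$, $$B_{n,q}(x)=E_{n,q}(x)+\frac{[n]_q(q-1)}{2[2]_q}E_{n-1,q}(x)+\sum_{k=0}^{n-2}\binom{n}{k}_qB_{n-k,q}E_{k,q}(x).$$
   Context: Fix a real number $q$ with $0<q<1$. For an integer $n\ge 0$ set $[n]_q=\frac{1-q^n}{1-q}$, $[0]_q!=1$, $[n]_q!=[1]_q\cdots[n]_q$, and $\binom{n}{k}_q=\frac{[n]_q!}{[k]_q![n-k]_q!}$ for $0\le k\le n$. Let $e_q(z)=\sum_{n=0}^{\infty}\frac{z^n}{[n]_q!}$. The $q$-Euler polynomials $E_{n,q}(x)$ are defined by the formal power series identity in $t$: $\frac{2}{e_q(t)+1}e_q(xt)=\sum_{n\ge0}E_{n,q}(x)\frac{t^n}{[n]_q!}$. The (Hegazi–Mansour) $q$-Bernoulli polynomials $B_{n,q}(x)$ are defined by $\frac{t}{e_q(t)-1}e_q(xt)=\sum_{n\ge0}B_{n,q}(x)\frac{t^n}{[n]_q!}$, and $B_{n,q}=B_{n,q}(0)$. *)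

theory Defs
  imports Complex_Main "HOL-Computational_Algebra.Formal_Power_Series"
begin

unbundle fps_syntax

definition q_int :: "real \<Rightarrow> nat \<Rightarrow> real" where
  "q_int q n = (1 - q ^ n) / (1 - q)"

definition q_fact :: "real \<Rightarrow> nat \<Rightarrow> real" where
  "q_fact q n = (\<Prod>k=1..n. q_int q k)"

(* Only meaningful for k \<le> n. *)
definition q_binomial :: "real \<Rightarrow> nat \<Rightarrow> nat \<Rightarrow> real" where
  "q_binomial q n k = q_fact q n / (q_fact q k * q_fact q (n - k))"

definition q_exp :: "real \<Rightarrow> real fps" where
  "q_exp q = Abs_fps (\<lambda>n. 1 / q_fact q n)"

(* The series e_q(x t) in the indeterminate t = fps_X, for a real number x. *)
definition q_exp_scaled :: "real \<Rightarrow> real \<Rightarrow> real fps" where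
  "q_exp_scaled q x = q_exp q oo (fps_const x * fps_X)"

(* The generating functions are series in t with the real number x as a parameter.  The constant
   terms of q_exp q + 1 and q_exp q - 1 are 2 and 0; since the t-coefficient of the latter is 1,
   the division of fps_X by it is exact (lemma q_bernoulli_quotient). *)
definition q_euler :: "real \<Rightarrow> nat \<Rightarrow> real \<Rightarrow> real" where
  "q_euler q n x = q_fact q n * (2 / (q_exp q + 1) * q_exp_scaled q x) $ n"

definition q_bernoulli :: "real \<Rightarrow> nat \<Rightarrow> real \<Rightarrow> real" where
  "q_bernoulli q n x = q_fact q n * (fps_X / (q_exp q - 1) * q_exp_scaled q x) $ n"

definition q_bernoulli_number :: "real \<Rightarrow> nat \<Rightarrow> real" where
  "q_bernoulli_number q n = q_bernoulli q n 0"

lemma q_fact_nonzero: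
  assumes "0 < q" "q < 1"
  shows "q_fact q n \<noteq> 0"
proof -
  have "q ^ k < 1" if "k \<ge> 1" for k
    using assms that by (simp add: power_Suc_less_one power_less_one_iff)
  then have "q_int q k \<noteq> 0" if "k \<ge> 1" for k
    using assms that unfolding q_int_def by fastforce
  then show ?thesis by (auto simp: q_fact_def)
qed

lemma q_exp_scaled_nth: "q_exp_scaled q x $ n = x ^ n / q_fact q n"
  by (simp add: q_exp_scaled_def q_exp_def fps_compose_linear)

lemma q_euler_quotient: "2 / (q_exp q + 1) * (q_exp q + 1) = 2"
proof -
  have "(q_exp q + 1) $ 0 \<noteq> 0" by (simp add: q_exp_def q_fact_def)
  then have "is_unit (q_exp q + 1)" by (simp add: fps_is_unit_iff)
  then show ?thesis by (simp add: unit_imp_dvd)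
qed

lemma q_bernoulli_quotient:
  assumes "q \<noteq> 1"
  shows "fps_X / (q_exp q - 1) * (q_exp q - 1) = fps_X"
proof -
  have 0: "(q_exp q - 1) $ 0 = 0" by (simp add: q_exp_def q_fact_def)
  have 1: "(q_exp q - 1) $ 1 \<noteq> 0" using assms by (simp add: q_exp_def q_fact_def q_int_def)
  have "subdegree (q_exp q - 1) = 1"
    by (rule subdegreeI) (use 0 1 in auto)
  moreover have "q_exp q - 1 \<noteq> 0" using 1 by auto
  ultimately have "q_exp q - 1 dvd fps_X" by (simp add: fps_dvd_iff)
  then show ?thesis by simp
qed

lemma q_euler_generating:
  assumes "0 < q" "q < 1"
  shows "2 / (q_exp q + 1) * q_exp_scaled q x = Abs_fps (\<lambda>n. q_euler q n x / q_fact q n)"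
  using q_fact_nonzero[OF assms] by (simp add: fps_eq_iff q_euler_def)

lemma q_bernoulli_generating:
  assumes "0 < q" "q < 1"
  shows "fps_X / (q_exp q - 1) * q_exp_scaled q x = Abs_fps (\<lambda>n. q_bernoulli q n x / q_fact q n)"
  using q_fact_nonzero[OF assms] by (simp add: fps_eq_iff q_bernoulli_def)

end

theory Submission
  imports Defs
begin

text \<open>
  Writing \<open>e = e\<^sub>q(t)\<close>, the identity \<open>e + 1 = (e - 1) + 2\<close> gives
  \<open>t / (e - 1) = 2 / (e + 1) * (t / 2 + t / (e - 1))\<close>. Multiply by \<open>e\<^sub>q(x t)\<close> and compare
  coefficients: the bracket has the coefficients \<open>B\<^sub>k / [k]!\<close>, except that the linear one is
  \<open>1 / 2 - 1 / [2] = (q - 1) / (2 [2])\<close>.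
\<close>

lemma q_int_1: "q \<noteq> 1 \<Longrightarrow> q_int q 1 = 1"
  by (simp add: q_int_def)

lemma q_int_2: "q \<noteq> 1 \<Longrightarrow> q_int q 2 = 1 + q"
  by (simp add: q_int_def field_simps power2_eq_square)

lemma q_fact_0 [simp]: "q_fact q 0 = 1"
  by (simp add: q_fact_def)

lemma q_fact_Suc: "q_fact q (Suc n) = q_int q (Suc n) * q_fact q n"
  by (simp add: q_fact_def)

lemma q_exp_scaled_0: "q_exp_scaled q 0 = 1"
  by (simp add: fps_eq_iff q_exp_scaled_nth power_0_left)

lemma q_bernoulli_number_eq:
  "q_bernoulli_number q n = q_fact q n * (fps_X / (q_exp q - 1)) $ n"
  by (simp add: q_bernoulli_number_def q_bernoulli_def q_exp_scaled_0)

text \<open>Multiplying the quotient by \<open>q_exp q - 1\<close>, which begins t + t^2 / [2], must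
  give t. Comparing the coefficients of t and t^2 determines the first two coefficients of the
  quotient in turn.\<close>

lemma q_bernoulli_series_nth_0_1:
  assumes "q \<noteq> 1"
  shows "(fps_X / (q_exp q - 1)) $ 0 = 1"
    and "(fps_X / (q_exp q - 1)) $ 1 = - 1 / q_int q 2"
proof -
  let ?b = "fps_X / (q_exp q - 1)"
  have e: "(q_exp q - 1) $ 0 = 0" "(q_exp q - 1) $ 1 = 1" "(q_exp q - 1) $ 2 = 1 / q_int q 2"
    using q_int_1[OF assms]
    by (simp_all add: q_exp_def q_fact_Suc numeral_2_eq_2)
  have "(?b * (q_exp q - 1)) $ 1 = 1" "(?b * (q_exp q - 1)) $ 2 = 0"
    by (simp_all only: q_bernoulli_quotient[OF assms]) simp_all
  then have "?b $ 0 = 1 \<and> ?b $ 1 = - 1 / q_int q 2"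
    using e by (simp add: fps_mult_nth numeral_2_eq_2)
  then show "?b $ 0 = 1" "?b $ 1 = - 1 / q_int q 2" by simp_all
qed

lemma q_bernoulli_series_eq:
  assumes "q \<noteq> 1"
  shows "fps_X / (q_exp q - 1) =
    2 / (q_exp q + 1) * (fps_const (1 / 2) * fps_X + fps_X / (q_exp q - 1))"
    (is "?b = ?e * (?h * fps_X + ?b)")
proof -
  have h: "2 * ?h = (1 :: real fps)"
    by (simp add: numeral_fps_const)
  \<comment> \<open>Both sides are doubled so that the factor 2 can be traded for
    \<open>?e * (q_exp q + 1)\<close>; it is cancelled at the end.\<close>
  have "2 * ?b = ?e * (q_exp q + 1) * ?b"
    by (simp only: q_euler_quotient)
  also have "\<dots> = ?e * (?b * (q_exp q - 1) + 2 * ?b)"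
    by (simp only: algebra_simps) simp
  also have "\<dots> = ?e * (2 * ?h * fps_X + 2 * ?b)"
    by (simp only: h q_bernoulli_quotient[OF assms] mult_1_left)
  also have "\<dots> = 2 * (?e * (?h * fps_X + ?b))"
    by (simp only: algebra_simps)
  finally show ?thesis by simp
qed

theorem theorem4:
  fixes q x :: real and n :: nat
  assumes "0 < q" and "q < 1" and "n \<ge> 2"
  shows "q_bernoulli q n x =
    q_euler q n x
    + q_int q n * (q - 1) / (2 * q_int q 2) * q_euler q (n - 1) x
    + (\<Sum>k = 0..n - 2. q_binomial q n k * q_bernoulli_number q (n - k) * q_euler q k x)"
proof -
  \<comment> \<open>With two successors exposed, \<open>simp\<close> can split the terms for
    \<open>k = n\<close> and \<open>k = n - 1\<close> off the convolution.\<close>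
  obtain m where n: "n = Suc (Suc m)"
    using assms(3) by (metis add_2_eq_Suc le_Suc_ex)
  have q1: "q \<noteq> 1" using assms by simp
  have nz: "q_fact q k \<noteq> 0" for k
    using q_fact_nonzero assms by blast
  define b where "b = fps_X / (q_exp q - 1)"
  define f where "f = 2 / (q_exp q + 1) * q_exp_scaled q x"
  have b0: "b $ 0 = 1" and b1: "b $ 1 = - 1 / q_int q 2"
    using q_bernoulli_series_nth_0_1[OF q1] by (simp_all add: b_def)
  have linear: "1 / 2 + b $ 1 = (q - 1) / (2 * q_int q 2)"
    using assms unfolding b1 q_int_2[OF q1] by (simp add: field_simps)
  have "b * q_exp_scaled q x = fps_const (1 / 2) * (fps_X * f) + f * b"
    unfolding f_def b_def
    \<comment> \<open>The left side of this equation recurs on its right, so it is applied only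
      once.\<close>
    by (subst q_bernoulli_series_eq[OF q1]) (simp only: algebra_simps)
  then have "(b * q_exp_scaled q x) $ n = f $ Suc m / 2 + (\<Sum>k = 0..n. f $ k * b $ (n - k))"
    by (simp add: n fps_mult_nth[of f b])
  \<comment> \<open>The top term has the factor \<open>b $ 0 = 1\<close>; the next one merges with
    the contribution of t / 2.\<close>
  also have "\<dots> = f $ n + (1 / 2 + b $ 1) * f $ Suc m + (\<Sum>k = 0..m. f $ k * b $ (n - k))"
    by (simp add: n b0 algebra_simps)
  finally have coeff: "(b * q_exp_scaled q x) $ n =
    f $ n + (q - 1) / (2 * q_int q 2) * f $ Suc m + (\<Sum>k = 0..m. f $ k * b $ (n - k))"
    by (simp only: linear)
  \<comment> \<open>The factorials in \<open>q_euler\<close> and \<open>q_bernoulli_number\<close>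
    cancel the denominator of \<open>q_binomial\<close>.\<close>
  have "q_fact q n * (f $ k * b $ (n - k)) =
    q_binomial q n k * q_bernoulli_number q (n - k) * q_euler q k x" for k
    using nz by (simp add: q_binomial_def q_bernoulli_number_eq q_euler_def f_def b_def)
  then have "(\<Sum>k = 0..m. q_binomial q n k * q_bernoulli_number q (n - k) * q_euler q k x) =
    q_fact q n * (\<Sum>k = 0..m. f $ k * b $ (n - k))"
    by (simp add: sum_distrib_left)
  \<comment> \<open>The factor [n] of the middle term arises from [n]! = [n] [n-1]!.\<close>
  moreover have "q_int q n * q_euler q (Suc m) x = q_fact q n * f $ Suc m"
    by (simp add: q_euler_def f_def n q_fact_Suc[of q "Suc m"])
  moreover have "q_euler q n x = q_fact q n * f $ n"
    by (simp add: q_euler_def f_def)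
  moreover have "q_bernoulli q n x = q_fact q n * (b * q_exp_scaled q x) $ n"
    by (simp add: q_bernoulli_def b_def)
  moreover have "n - 1 = Suc m" "n - 2 = m" by (simp_all add: n)
  ultimately show ?thesis
    unfolding coeff by (simp add: distrib_left mult.assoc mult.left_commute)
qed

end
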